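(* Let $\mathcal{S}$ be a horizontal strip in $\mathbb{C}$, and let $\mathcal{G}\subseteq\mathbb{C}$ be a domain. Let $F(s,z_1,z_2,\ldots,z_k):\mathcal{S}\times\mathcal{G}^k\to\mathcal{G}$ be a holomorphic function. Suppose for all compact sets $\mathcal{K}\subset\mathcal{S}$ and $\mathcal{N}\subset\mathcal{G}$, $$\sum_{j=1}^\infty \|F(s-j,z_1,z_2,\ldots,z_k)-A\|_{\mathcal{K},\mathcal{N}^k}<\infty$$ for some $A\in\mathbb{C}$. Then there exists a holomorphic function $y:\mathcal{S}\to\mathcal{G}$ such that $$y(s+k)=F(s,y(s),y(s+1),\ldots,y(s+k-1)).$$
   Context: Here $k$ is a positive integer (the order of the equation). A domain is a nonempty connected open subset of $\mathbb{C}$. A horizontal strip is a set of the form $\mathcal{S}=\{s\in\mathbb{C} : |\Im(s)|<a\}$ with $a>0$. The norm denotes the supremum norm: $\|f(s,z_1,\ldots,z_k)\|_{\mathcal{K},\mathcal{N}^k}=\sup_{s\in\mathcal{K},\,z_1,\ldots,z_k\in\mathcal{N}}|f(s,z_1,\ldots,z_k)|$.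
   Formalization: The limit A is required to lie in 𝒢, not merely in ℂ; without this the claim is false, e.g. k=1, 𝒮={|Im s|<1}, 𝒢={Re z>0}, A=0, F(s,z)=1/(1/z+e^{-s}). *)

theory Defs
  imports "HOL-Complex_Analysis.Complex_Analysis"
begin

definition horizontal_strip :: "complex set \<Rightarrow> bool" where
  "horizontal_strip S \<longleftrightarrow> (\<exists>a>0. S = {s. \<bar>Im s\<bar> < a})"

definition complex_domain :: "complex set \<Rightarrow> bool" where
  "complex_domain G \<longleftrightarrow> G \<noteq> {} \<and> open G \<and> connected G"

text \<open>A point \<open>(z\<^sub>1, \<dots>, z\<^sub>k)\<close> of \<open>N\<^sup>k\<close> is the extensional function on \<open>{..<k}\<close> sending \<open>i\<close> to
  the coordinate \<open>z\<^sub>i\<^sub>+\<^sub>1\<close>, so that \<open>k\<close> can be a natural number rather than a type.\<close>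

abbreviation cart_power :: "complex set \<Rightarrow> nat \<Rightarrow> (nat \<Rightarrow> complex) set" where
  "cart_power N k \<equiv> (\<Pi>\<^sub>E i\<in>{..<k}. N)"

text \<open>Holomorphy in the \<open>k + 1\<close> variables \<open>(s, z\<^sub>1, \<dots>, z\<^sub>k)\<close> jointly: complex (Frechet)
  differentiability at every point, with derivative
  \<open>(h, w\<^sub>1, \<dots>, w\<^sub>k) \<mapsto> a h + b\<^sub>1 w\<^sub>1 + \<dots> + b\<^sub>k w\<^sub>k\<close>.  Meant for open \<open>S\<close> and \<open>G\<close>.\<close>

definition jointly_holomorphic_on ::
  "nat \<Rightarrow> (complex \<Rightarrow> (nat \<Rightarrow> complex) \<Rightarrow> complex) \<Rightarrow> complex set \<Rightarrow> complex set \<Rightarrow> bool" where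
  "jointly_holomorphic_on k F S G \<longleftrightarrow>
    (\<forall>s0\<in>S. \<forall>z0\<in>cart_power G k. \<exists>a b. \<forall>e>0. \<exists>d>0. \<forall>s\<in>S. \<forall>z\<in>cart_power G k.
       norm (s - s0) < d \<and> (\<forall>i<k. norm (z i - z0 i) < d) \<longrightarrow>
       norm (F s z - F s0 z0 - (a * (s - s0) + (\<Sum>i<k. b i * (z i - z0 i))))
         \<le> e * (norm (s - s0) + (\<Sum>i<k. norm (z i - z0 i))))"

text \<open>The supremum is taken in \<^typ>\<open>ennreal\<close>, so that it is \<open>\<infinity>\<close> for unbounded functions and
  \<open>0\<close> if \<open>K\<close> or \<open>N\<close> is empty.\<close>

definition sup_norm ::
  "nat \<Rightarrow> complex set \<Rightarrow> complex set \<Rightarrow> (complex \<Rightarrow> (nat \<Rightarrow> complex) \<Rightarrow> complex) \<Rightarrow> ennreal" where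
  "sup_norm k K N f = (SUP s\<in>K. SUP z\<in>cart_power N k. ennreal (norm (f s z)))"

text \<open>The theorem places the limit \<open>A\<close> in \<open>G\<close>, where the source only writes \<open>A \<in> \<complex>\<close>.  Without this the
  claim is false: take \<open>k = 1\<close>, \<open>S = {s. \<bar>Im s\<bar> < 1}\<close>, \<open>G = {z. Re z > 0}\<close>, \<open>A = 0\<close> and
  \<open>F s z = 1 / (1 / z + exp (- s))\<close>.  The series converges, but a solution \<open>y\<close> would satisfy
  \<open>Re (1 / y 0) = Re (1 / y (- n)) + (\<Sum>j=1..n. exp j) > n\<close> for every \<open>n\<close>.\<close>

end

theory Submission
  imports Defs
begin

text \<open>The solution is obtained by starting the recursion ever further to the left with the constant
  initial values \<open>A\<close>. Let \<open>march k A F n s\<close> be the value at \<open>s\<close> of the sequence that is \<open>A\<close> at the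
  \<open>k\<close> points \<open>s - n, \<dots>, s - n + k - 1\<close> and obeys the equation from there on. These
  functions are holomorphic and \<open>G\<close>-valued on the strip, and by construction
  \<open>march (n + k) (s + k) = F s (march n s, \<dots>, march (n + k - 1) (s + k - 1))\<close>. If they
  converge locally uniformly to a \<open>G\<close>-valued function \<open>y\<close>, then \<open>y\<close> is holomorphic and solves the
  equation.

  Far to the left they do converge (\<open>march_increment\<close>). Choose \<open>r > 0\<close> with \<open>cball A r \<subseteq> G\<close>. The
  summability gives that, near \<open>s - m\<close> with \<open>m\<close> large, \<open>F\<close> stays within any prescribed \<open>\<eta>\<close> of the
  constant \<open>A\<close> as its other arguments range over \<open>cball A r\<close>. By Cauchy's inequality \<open>F\<close> is then
  Lipschitz in these arguments with a constant of order \<open>\<eta> / r\<close>, on a smaller ball. For small \<open>\<eta>\<close> the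
  recursion is a contraction, and the increments in \<open>n\<close> decay geometrically.

  From the left the convergence is carried to the whole strip by the equation itself
  (\<open>march_converges_step\<close>). For this, locally uniform convergence is used in the form of continuous
  convergence, \<open>f n u \<longrightarrow> l\<close> as \<open>n \<rightarrow> \<infinity>\<close> and \<open>u \<rightarrow> s\<close> simultaneously: in
  this form it passes through \<open>F\<close> by mere continuity of \<open>F\<close>, and once it holds at every point of
  the strip it gives uniform convergence on compact sets.\<close>

section \<open>Composition with jointly holomorphic functions\<close>

text \<open>The definition of joint holomorphy, read along an arbitrary filter. Continuity and the chain rule
  are both consequences.\<close>

lemma jointly_holomorphic_expansion:
  fixes \<sigma> :: "'b \<Rightarrow> complex" and \<zeta> :: "nat \<Rightarrow> 'b \<Rightarrow> complex"
  assumes F: "jointly_holomorphic_on k F S G" and "open S" "open G"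
    and s0: "s0 \<in> S" and z0: "\<And>i. i < k \<Longrightarrow> z0 i \<in> G"
    and \<sigma>: "(\<sigma> \<longlongrightarrow> s0) L" and \<zeta>: "\<And>i. i < k \<Longrightarrow> (\<zeta> i \<longlongrightarrow> z0 i) L"
  obtains a b where "\<And>e. e > 0 \<Longrightarrow> \<forall>\<^sub>F x in L.
      norm (F (\<sigma> x) (\<lambda>i\<in>{..<k}. \<zeta> i x) - F s0 (\<lambda>i\<in>{..<k}. z0 i)
          - (a * (\<sigma> x - s0) + (\<Sum>i<k. b i * (\<zeta> i x - z0 i))))
        \<le> e * (norm (\<sigma> x - s0) + (\<Sum>i<k. norm (\<zeta> i x - z0 i)))"
proof -
  let ?r = "\<lambda>i\<in>{..<k}. z0 i"
  have "?r \<in> cart_power G k" using z0 by auto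
  from F[unfolded jointly_holomorphic_on_def, rule_format, OF s0 this]
  obtain a b where ab: "\<And>e. e > 0 \<Longrightarrow> \<exists>d>0. \<forall>s\<in>S. \<forall>z\<in>cart_power G k.
       norm (s - s0) < d \<and> (\<forall>i<k. norm (z i - ?r i) < d) \<longrightarrow>
       norm (F s z - F s0 ?r - (a * (s - s0) + (\<Sum>i<k. b i * (z i - ?r i))))
         \<le> e * (norm (s - s0) + (\<Sum>i<k. norm (z i - ?r i)))"
    by blast
  show thesis
  proof (rule that[of a b])
    fix e :: real assume "e > 0"
    from ab[OF this] obtain d where "d > 0" and d: "\<And>s z. s \<in> S \<Longrightarrow> z \<in> cart_power G k \<Longrightarrow>
       norm (s - s0) < d \<Longrightarrow> (\<forall>i<k. norm (z i - ?r i) < d) \<Longrightarrow>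
       norm (F s z - F s0 ?r - (a * (s - s0) + (\<Sum>i<k. b i * (z i - ?r i))))
         \<le> e * (norm (s - s0) + (\<Sum>i<k. norm (z i - ?r i)))" by blast
    have 1: "\<forall>\<^sub>F x in L. \<sigma> x \<in> S" using topological_tendstoD[OF \<sigma> \<open>open S\<close> s0] .
    have 2: "\<forall>\<^sub>F x in L. \<forall>i\<in>{..<k}. \<zeta> i x \<in> G"
      using topological_tendstoD[OF \<zeta> \<open>open G\<close> z0] by (intro eventually_ball_finite) auto
    have 3: "\<forall>\<^sub>F x in L. norm (\<sigma> x - s0) < d"
      using tendstoD[OF \<sigma> \<open>d > 0\<close>] by (simp add: dist_norm)
    have 4: "\<forall>\<^sub>F x in L. \<forall>i\<in>{..<k}. norm (\<zeta> i x - z0 i) < d"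
      using tendstoD[OF \<zeta> \<open>d > 0\<close>] by (intro eventually_ball_finite) (auto simp: dist_norm)
    show "\<forall>\<^sub>F x in L.
      norm (F (\<sigma> x) (\<lambda>i\<in>{..<k}. \<zeta> i x) - F s0 (\<lambda>i\<in>{..<k}. z0 i)
          - (a * (\<sigma> x - s0) + (\<Sum>i<k. b i * (\<zeta> i x - z0 i))))
        \<le> e * (norm (\<sigma> x - s0) + (\<Sum>i<k. norm (\<zeta> i x - z0 i)))"
      using 1 2 3 4
    proof eventually_elim
      case (elim x)
      show ?case using d[of "\<sigma> x" "\<lambda>i\<in>{..<k}. \<zeta> i x"] elim by (auto simp: PiE_def Pi_def)
    qed
  qed
qed

lemma tendsto_jointly_holomorphic:
  fixes \<sigma> :: "'b \<Rightarrow> complex" and \<zeta> :: "nat \<Rightarrow> 'b \<Rightarrow> complex"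
  assumes F: "jointly_holomorphic_on k F S G" and "open S" "open G"
    and s0: "s0 \<in> S" and z0: "\<And>i. i < k \<Longrightarrow> z0 i \<in> G"
    and \<sigma>: "(\<sigma> \<longlongrightarrow> s0) L" and \<zeta>: "\<And>i. i < k \<Longrightarrow> (\<zeta> i \<longlongrightarrow> z0 i) L"
  shows "((\<lambda>x. F (\<sigma> x) (\<lambda>i\<in>{..<k}. \<zeta> i x)) \<longlongrightarrow> F s0 (\<lambda>i\<in>{..<k}. z0 i)) L"
proof -
  obtain a b where
    ab: "\<And>e. e > 0 \<Longrightarrow> \<forall>\<^sub>F x in L.
      norm (F (\<sigma> x) (\<lambda>i\<in>{..<k}. \<zeta> i x) - F s0 (\<lambda>i\<in>{..<k}. z0 i)
          - (a * (\<sigma> x - s0) + (\<Sum>i<k. b i * (\<zeta> i x - z0 i))))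
        \<le> e * (norm (\<sigma> x - s0) + (\<Sum>i<k. norm (\<zeta> i x - z0 i)))"
    using jointly_holomorphic_expansion[OF F \<open>open S\<close> \<open>open G\<close> s0, of z0 \<sigma> L \<zeta>, OF z0 \<sigma> \<zeta>] by blast
  have dist0: "((\<lambda>x. norm (\<sigma> x - s0) + (\<Sum>i<k. norm (\<zeta> i x - z0 i))) \<longlongrightarrow>
      norm (s0 - s0) + (\<Sum>i<k. norm (z0 i - z0 i))) L"
    by (intro tendsto_intros \<sigma> \<zeta>) auto
  have "((\<lambda>x. F (\<sigma> x) (\<lambda>i\<in>{..<k}. \<zeta> i x) - F s0 (\<lambda>i\<in>{..<k}. z0 i)
          - (a * (\<sigma> x - s0) + (\<Sum>i<k. b i * (\<zeta> i x - z0 i)))) \<longlongrightarrow> 0) L"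
  proof (rule tendsto_0_le[where K = 1])
    show "((\<lambda>x. norm (\<sigma> x - s0) + (\<Sum>i<k. norm (\<zeta> i x - z0 i))) \<longlongrightarrow> 0) L"
      using dist0 by simp
    show "\<forall>\<^sub>F x in L. norm (F (\<sigma> x) (\<lambda>i\<in>{..<k}. \<zeta> i x) - F s0 (\<lambda>i\<in>{..<k}. z0 i)
          - (a * (\<sigma> x - s0) + (\<Sum>i<k. b i * (\<zeta> i x - z0 i))))
        \<le> norm (norm (\<sigma> x - s0) + (\<Sum>i<k. norm (\<zeta> i x - z0 i))) * 1"
      using ab[OF zero_less_one] by eventually_elim (simp add: sum_nonneg)
  qed
  moreover have "((\<lambda>x. a * (\<sigma> x - s0) + (\<Sum>i<k. b i * (\<zeta> i x - z0 i))) \<longlongrightarrow>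
      a * (s0 - s0) + (\<Sum>i<k. b i * (z0 i - z0 i))) L"
    by (intro tendsto_intros \<sigma> \<zeta>) auto
  ultimately have "((\<lambda>x. F (\<sigma> x) (\<lambda>i\<in>{..<k}. \<zeta> i x) - F s0 (\<lambda>i\<in>{..<k}. z0 i)) \<longlongrightarrow> 0) L"
    using tendsto_add by fastforce
  then show ?thesis by (rule LIM_zero_cancel)
qed

lemma holomorphic_on_jointly_holomorphic:
  assumes F: "jointly_holomorphic_on k F S G" and "open S" "open G" "open T"
    and \<sigma>: "\<sigma> holomorphic_on T" "\<And>t. t \<in> T \<Longrightarrow> \<sigma> t \<in> S"
    and \<zeta>: "\<And>i. i < k \<Longrightarrow> \<zeta> i holomorphic_on T" "\<And>i t. i < k \<Longrightarrow> t \<in> T \<Longrightarrow> \<zeta> i t \<in> G"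
  shows "(\<lambda>t. F (\<sigma> t) (\<lambda>i\<in>{..<k}. \<zeta> i t)) holomorphic_on T"
proof -
  have "\<exists>D. ((\<lambda>t. F (\<sigma> t) (\<lambda>i\<in>{..<k}. \<zeta> i t)) has_field_derivative D) (at t0)" if t0: "t0 \<in> T" for t0
  proof -
    have der\<sigma>: "(\<sigma> has_field_derivative deriv \<sigma> t0) (at t0)"
      using holomorphic_derivI[OF \<sigma>(1) \<open>open T\<close> t0] .
    have der\<zeta>: "(\<zeta> i has_field_derivative deriv (\<zeta> i) t0) (at t0)" if "i < k" for i
      using holomorphic_derivI[OF \<zeta>(1)[OF that] \<open>open T\<close> t0] .
    have q\<sigma>: "((\<lambda>t. (\<sigma> t - \<sigma> t0) / (t - t0)) \<longlongrightarrow> deriv \<sigma> t0) (at t0)"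
      using der\<sigma> by (simp add: has_field_derivative_iff)
    have q\<zeta>: "((\<lambda>t. (\<zeta> i t - \<zeta> i t0) / (t - t0)) \<longlongrightarrow> deriv (\<zeta> i) t0) (at t0)" if "i < k" for i
      using der\<zeta>[OF that] by (simp add: has_field_derivative_iff)
    have c\<sigma>: "(\<sigma> \<longlongrightarrow> \<sigma> t0) (at t0)" using DERIV_isCont[OF der\<sigma>] by (simp add: isCont_def)
    have c\<zeta>: "(\<zeta> i \<longlongrightarrow> \<zeta> i t0) (at t0)" if "i < k" for i
      using DERIV_isCont[OF der\<zeta>[OF that]] by (simp add: isCont_def)
    obtain a b where
      ab: "\<And>e. e > 0 \<Longrightarrow> \<forall>\<^sub>F t in at t0.
      norm (F (\<sigma> t) (\<lambda>i\<in>{..<k}. \<zeta> i t) - F (\<sigma> t0) (\<lambda>i\<in>{..<k}. \<zeta> i t0)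
          - (a * (\<sigma> t - \<sigma> t0) + (\<Sum>i<k. b i * (\<zeta> i t - \<zeta> i t0))))
        \<le> e * (norm (\<sigma> t - \<sigma> t0) + (\<Sum>i<k. norm (\<zeta> i t - \<zeta> i t0)))"
      using jointly_holomorphic_expansion[OF F \<open>open S\<close> \<open>open G\<close> \<sigma>(2)[OF t0], of "\<lambda>i. \<zeta> i t0", OF \<zeta>(2)[OF _ t0] c\<sigma> c\<zeta>]
      by blast
    let ?R = "\<lambda>t. F (\<sigma> t) (\<lambda>i\<in>{..<k}. \<zeta> i t) - F (\<sigma> t0) (\<lambda>i\<in>{..<k}. \<zeta> i t0)
          - (a * (\<sigma> t - \<sigma> t0) + (\<Sum>i<k. b i * (\<zeta> i t - \<zeta> i t0)))"
    let ?q = "\<lambda>t. norm ((\<sigma> t - \<sigma> t0) / (t - t0)) + (\<Sum>i<k. norm ((\<zeta> i t - \<zeta> i t0) / (t - t0)))"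
    let ?Q = "norm (deriv \<sigma> t0) + (\<Sum>i<k. norm (deriv (\<zeta> i) t0))"
    have q: "(?q \<longlongrightarrow> ?Q) (at t0)" by (intro tendsto_intros q\<sigma> q\<zeta>) auto
    have Q0: "?Q \<ge> 0" by (simp add: sum_nonneg)
    have R: "((\<lambda>t. ?R t / (t - t0)) \<longlongrightarrow> 0) (at t0)"
    proof (rule tendstoI)
      fix e :: real assume "e > 0"
      (* The denominator exceeds both 0 and the eventual bound ?Q + 1 on ?q. *)
      define e' where "e' = e / (?Q + 2)"
      have "e' > 0" using \<open>e > 0\<close> Q0 by (simp add: e'_def)
      have "\<forall>\<^sub>F t in at t0. ?q t < ?Q + 1" using order_tendstoD(2)[OF q] by simp
      moreover have "\<forall>\<^sub>F t in at t0. t \<noteq> t0" by (simp add: eventually_at_filter)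
      ultimately show "\<forall>\<^sub>F t in at t0. dist (?R t / (t - t0)) 0 < e"
        using ab[OF \<open>e' > 0\<close>]
      proof eventually_elim
        case (elim t)
        have "norm (?R t / (t - t0)) = norm (?R t) / norm (t - t0)" by (rule norm_divide)
        also have "\<dots> \<le> e' * (norm (\<sigma> t - \<sigma> t0) + (\<Sum>i<k. norm (\<zeta> i t - \<zeta> i t0))) / norm (t - t0)"
          using elim(3) by (rule divide_right_mono) simp
        also have "\<dots> = e' * ?q t"
          by (simp add: norm_divide sum_divide_distrib[symmetric] add_divide_distrib[symmetric])
        also have "\<dots> \<le> e' * (?Q + 1)" using elim(1) \<open>e' > 0\<close> by (intro mult_left_mono) auto
        also have "\<dots> < e' * (?Q + 2)" using \<open>e' > 0\<close> by (intro mult_strict_left_mono) auto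
        also have "\<dots> = e" using Q0 by (simp add: e'_def)
        finally show ?case by simp
      qed
    qed
    have "((\<lambda>t. ?R t / (t - t0) + (a * ((\<sigma> t - \<sigma> t0) / (t - t0)) +
            (\<Sum>i<k. b i * ((\<zeta> i t - \<zeta> i t0) / (t - t0))))) \<longlongrightarrow>
          0 + (a * deriv \<sigma> t0 + (\<Sum>i<k. b i * deriv (\<zeta> i) t0))) (at t0)"
      by (intro tendsto_intros R q\<sigma> q\<zeta>) auto
    also have "(\<lambda>t. ?R t / (t - t0) + (a * ((\<sigma> t - \<sigma> t0) / (t - t0)) +
            (\<Sum>i<k. b i * ((\<zeta> i t - \<zeta> i t0) / (t - t0))))) =
      (\<lambda>t. (F (\<sigma> t) (\<lambda>i\<in>{..<k}. \<zeta> i t) - F (\<sigma> t0) (\<lambda>i\<in>{..<k}. \<zeta> i t0)) / (t - t0))"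
      by (simp add: sum_divide_distrib[symmetric] add_divide_distrib[symmetric])
    finally show ?thesis unfolding has_field_derivative_iff by blast
  qed
  then show ?thesis using \<open>open T\<close>
    by (auto simp: holomorphic_on_open)
qed

section \<open>A Lipschitz estimate from a bound on the oscillation\<close>

text \<open>Cauchy's inequality on the discs of radius \<open>R / 4\<close> around the points of the segment from \<open>0\<close>
  to \<open>1\<close>; they lie in \<open>ball 0 R\<close> because \<open>1 + R / 4 < R\<close>.\<close>

lemma holomorphic_increment_bound:
  assumes f: "f holomorphic_on ball 0 R" and "R \<ge> 2"
    and bound: "\<And>t. t \<in> ball 0 R \<Longrightarrow> norm (f t - A) \<le> \<eta>"
  shows "norm (f 1 - f 0) \<le> 4 * \<eta> / R"
proof -
  have der: "norm (deriv f t) \<le> 4 * \<eta> / R" if t: "t \<in> closed_segment 0 1" for t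
  proof -
    have "norm t \<le> 1" using segment_bound[OF t] by simp
    then have sub: "cball t (R / 4) \<subseteq> ball 0 R"
      using \<open>R \<ge> 2\<close> by (intro subsetI) (simp add: dist_norm, smt (verit) norm_minus_commute norm_triangle_sub field_sum_of_halves)
    have hol: "(\<lambda>t. f t - A) holomorphic_on cball t (R / 4)"
      using holomorphic_on_subset[OF f sub] by (intro holomorphic_intros)
    have "norm ((deriv ^^ 1) (\<lambda>t. f t - A) t) \<le> fact 1 * \<eta> / (R / 4) ^ 1"
    proof (rule Cauchy_inequality)
      show "(\<lambda>t. f t - A) holomorphic_on ball t (R / 4)"
        using hol holomorphic_on_subset ball_subset_cball by blast
      show "continuous_on (cball t (R / 4)) (\<lambda>t. f t - A)"
        using hol by (rule holomorphic_on_imp_continuous_on)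
      show "norm (f x - A) \<le> \<eta>" if "norm (t - x) = R / 4" for x
        using bound sub that by (auto simp: dist_norm)
    qed (use \<open>R \<ge> 2\<close> in auto)
    moreover have "f field_differentiable at t"
      using f sub \<open>R \<ge> 2\<close> by (intro holomorphic_on_imp_differentiable_at[OF f] subsetD[OF sub]) auto
    ultimately show ?thesis by (simp add: mult.commute)
  qed
  have "norm (f 1 - f 0) \<le> 4 * \<eta> / R * norm (1 - 0 :: complex)"
  proof (rule field_differentiable_bound[where S = "closed_segment 0 1"])
    fix t :: complex assume t: "t \<in> closed_segment 0 1"
    have "norm t \<le> 1" using segment_bound[OF t] by simp
    then have "t \<in> ball 0 R" using \<open>R \<ge> 2\<close> by simp
    then show "(f has_field_derivative deriv f t) (at t within closed_segment 0 1)"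
      using holomorphic_derivI[OF f open_ball] by blast
  qed (use der in auto)
  then show ?thesis by simp
qed

text \<open>One complex variable suffices: on the complex line \<open>t \<mapsto> z + t (w - z)\<close> through both points
  all coordinates stay in \<open>cball A r\<close> for \<open>\<bar>t\<bar> < r / (2 \<delta>)\<close>, a disc that is large when \<open>z\<close> and \<open>w\<close>
  are close to each other.\<close>

lemma jointly_holomorphic_Lipschitz:
  assumes F: "jointly_holomorphic_on k F S G" and "open S" "open G" and "s \<in> S"
    and sub: "cball A r \<subseteq> G" and "0 < \<delta>" "\<delta> \<le> r / 4"
    and bound: "\<And>z. z \<in> cart_power (cball A r) k \<Longrightarrow> norm (F s z - A) \<le> \<eta>"
    and z: "\<And>i. i < k \<Longrightarrow> norm (z i - A) \<le> r / 2"
    and zw: "\<And>i. i < k \<Longrightarrow> norm (w i - z i) \<le> \<delta>"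
  shows "norm (F s (\<lambda>i\<in>{..<k}. w i) - F s (\<lambda>i\<in>{..<k}. z i)) \<le> 8 * \<eta> * \<delta> / r"
proof -
  define R where "R = r / (2 * \<delta>)"
  let ?l = "\<lambda>i t. z i + t * (w i - z i)"
  let ?f = "\<lambda>t. F s (\<lambda>i\<in>{..<k}. ?l i t)"
  have "R \<ge> 2" using assms(6,7) by (simp add: R_def field_simps)
  have l: "?l i t \<in> cball A r" if "i < k" "t \<in> ball 0 R" for i t
  proof -
    have "norm (t * (w i - z i)) \<le> R * \<delta>"
      unfolding norm_mult using that zw \<open>R \<ge> 2\<close> by (intro mult_mono) auto
    also have "\<dots> = r / 2" using \<open>0 < \<delta>\<close> by (simp add: R_def)
    finally have "norm (?l i t - A) \<le> r"
      using norm_triangle_ineq[of "z i - A" "t * (w i - z i)"] z[OF that(1)]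
      by (simp add: algebra_simps)
    then show ?thesis by (simp only: mem_cball dist_norm norm_minus_commute[of A])
  qed
  have "norm (?f 1 - ?f 0) \<le> 4 * \<eta> / R"
  proof (rule holomorphic_increment_bound[where A = A])
    show "?f holomorphic_on ball 0 R"
      by (rule holomorphic_on_jointly_holomorphic[OF F \<open>open S\<close> \<open>open G\<close>])
         (use l sub \<open>s \<in> S\<close> in \<open>auto intro!: holomorphic_intros\<close>)
    show "norm (?f t - A) \<le> \<eta>" if "t \<in> ball 0 R" for t
      using l that by (intro bound) (auto simp del: mem_cball)
  qed fact
  then show ?thesis by (simp add: R_def)
qed

section \<open>Continuous convergence\<close>

abbreviation converges_continuously_at ::
    "(nat \<Rightarrow> 'a::topological_space \<Rightarrow> 'b::topological_space) \<Rightarrow> 'b \<Rightarrow> 'a \<Rightarrow> bool" where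
  "converges_continuously_at f l x \<equiv>
     ((\<lambda>p. f (fst p) (snd p)) \<longlongrightarrow> l) (sequentially \<times>\<^sub>F nhds x)"

lemma filterlim_Pair_const_nhds: "filterlim (\<lambda>n. (n, x)) (sequentially \<times>\<^sub>F nhds x) sequentially"
  by (intro filterlim_Pair filterlim_ident tendsto_const)

lemma converges_continuously_imp_tendsto:
  assumes "converges_continuously_at f l x"
  shows "(\<lambda>n. f n x) \<longlonglongrightarrow> l"
  using filterlim_compose[OF assms filterlim_Pair_const_nhds] by simp

lemma geometric_imp_converges_continuously:
  fixes f :: "nat \<Rightarrow> 'a::topological_space \<Rightarrow> 'b::banach"
  assumes "open U" "x \<in> U" and cont: "\<And>n. continuous_on U (f n)"
    and step: "\<And>n u. u \<in> U \<Longrightarrow> norm (f (Suc n) u - f n u) \<le> C * (1 / 2) ^ n"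
  shows "\<exists>l. converges_continuously_at f l x"
proof -
  have "uniformly_convergent_on U (\<lambda>n u. \<Sum>i<n. f (Suc i) u - f i u)"
    by (rule Weierstrass_m_test'[OF step]) (auto intro!: summable_mult summable_geometric)
  then have "uniformly_convergent_on U (\<lambda>n u. f n u - f 0 u)"
    by (simp only: sum_lessThan_telescope[of "\<lambda>i. f i u" for u])
  then obtain g where g: "uniform_limit U (\<lambda>n u. f n u - f 0 u) g sequentially"
    unfolding uniformly_convergent_on_def ..
  let ?h = "\<lambda>u. g u + f 0 u"
  have ul: "uniform_limit U f ?h sequentially"
    using g unfolding uniform_limit_iff dist_norm by (simp add: algebra_simps)
  have "continuous_on U ?h"
    by (rule uniform_limit_theorem[OF _ ul]) (use cont in auto)
  then have "(?h \<longlongrightarrow> ?h x) (at x within U)"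
    unfolding continuous_on_def using \<open>x \<in> U\<close> by blast
  then have "(?h \<longlongrightarrow> ?h x) (at x)"
    by (simp only: at_within_open[OF \<open>x \<in> U\<close> \<open>open U\<close>])
  then have h: "(?h \<longlongrightarrow> ?h x) (nhds x)"
    by (rule tendsto_at_iff_tendsto_nhds[of ?h x, THEN iffD1])
  have "converges_continuously_at f (?h x) x"
  proof (rule tendstoI)
    fix e :: real assume "e > 0"
    then have e: "e / 2 > 0" by simp
    have ev1: "\<forall>\<^sub>F n in sequentially. \<forall>u\<in>U. dist (f n u) (?h u) < e / 2"
      using ul e unfolding uniform_limit_iff by blast
    have ev2: "\<forall>\<^sub>F u in nhds x. u \<in> U \<and> dist (?h u) (?h x) < e / 2"
      by (intro eventually_conj eventually_nhds_in_open tendstoD[OF h e] assms)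
    show "\<forall>\<^sub>F p in sequentially \<times>\<^sub>F nhds x. dist (f (fst p) (snd p)) (?h x) < e"
      using eventually_prodI[OF ev1 ev2]
    proof eventually_elim
      case (elim p)
      have "dist (f (fst p) (snd p)) (?h (snd p)) < e / 2" using elim by blast
      moreover have "dist (?h (snd p)) (?h x) < e / 2" using elim by blast
      ultimately show ?case
        using dist_triangle[of "f (fst p) (snd p)" "?h x" "?h (snd p)"] by linarith
    qed
  qed
  then show ?thesis ..
qed

text \<open>Continuous convergence at \<open>x\<close> controls \<open>f n u\<close> for all large \<open>n\<close> and all \<open>u\<close> near \<open>x\<close> by
  \<open>g x\<close>; letting \<open>n \<rightarrow> \<infinity>\<close> it also controls \<open>g u\<close>. So the convergence is \<open>e\<close>-uniform on a
  neighbourhood of each point, and finitely many of these cover \<open>K\<close>.\<close>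

lemma converges_continuously_imp_uniform_limit:
  fixes f :: "nat \<Rightarrow> 'a::topological_space \<Rightarrow> 'b::metric_space"
  assumes "compact K" and conv: "\<And>x. x \<in> K \<Longrightarrow> converges_continuously_at f (g x) x"
  shows "uniform_limit K f g sequentially"
proof (rule uniform_limitI)
  fix e :: real assume "e > 0"
  have "\<exists>N U. open U \<and> x \<in> U \<and> (\<forall>n\<ge>N. \<forall>u\<in>U\<inter>K. dist (f n u) (g u) < e)" if "x \<in> K" for x
  proof -
    have "\<forall>\<^sub>F p in sequentially \<times>\<^sub>F nhds x. dist (f (fst p) (snd p)) (g x) < e / 3"
      using tendstoD[OF conv[OF that], of "e / 3"] \<open>e > 0\<close> by simp
    then obtain N U where U: "open U" "x \<in> U"
      and *: "\<And>n u. n \<ge> N \<Longrightarrow> u \<in> U \<Longrightarrow> dist (f n u) (g x) < e / 3"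
      unfolding eventually_prod_filter eventually_sequentially eventually_nhds fst_conv snd_conv
      by metis
    have "dist (f n u) (g u) < e" if "n \<ge> N" "u \<in> U" "u \<in> K" for n u
    proof -
      have "dist (g u) (g x) \<le> e / 3"
      proof (rule tendsto_upperbound)
        show "(\<lambda>n. dist (f n u) (g x)) \<longlonglongrightarrow> dist (g u) (g x)"
          by (intro tendsto_intros converges_continuously_imp_tendsto conv that)
        show "\<forall>\<^sub>F n in sequentially. dist (f n u) (g x) \<le> e / 3"
          using * that by (auto simp: eventually_sequentially intro!: exI[of _ N] less_imp_le)
      qed simp
      then show ?thesis
        using *[OF that(1,2)] dist_triangle2[of "f n u" "g u" "g x"] \<open>e > 0\<close> by linarith
    qed
    with U show ?thesis by blast
  qed
  then obtain N U where NU: "\<And>x. x \<in> K \<Longrightarrow> open (U x) \<and> x \<in> U x \<and>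
      (\<forall>n\<ge>N x. \<forall>u\<in>U x\<inter>K. dist (f n u) (g u) < e)" by metis
  obtain C where C: "C \<subseteq> K" "finite C" "K \<subseteq> (\<Union>c\<in>C. U c)"
    by (rule compactE_image[OF \<open>compact K\<close>, of K U]) (use NU in auto)
  have "\<forall>\<^sub>F n in sequentially. \<forall>c\<in>C. n \<ge> N c"
    by (intro eventually_ball_finite C) (auto simp: eventually_ge_at_top)
  then show "\<forall>\<^sub>F n in sequentially. \<forall>x\<in>K. dist (f n x) (g x) < e"
  proof eventually_elim
    case (elim n)
    show ?case
    proof
      fix x assume "x \<in> K"
      with C obtain c where "c \<in> C" "x \<in> U c" by auto
      then show "dist (f n x) (g x) < e" using NU[of c] C elim \<open>x \<in> K\<close> by auto
    qed
  qed
qed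

lemma converges_continuously_imp_holomorphic:
  assumes "open S" and "\<And>n. f n holomorphic_on S"
    and "\<And>s. s \<in> S \<Longrightarrow> converges_continuously_at f (g s) s"
  shows "g holomorphic_on S"
proof (rule holomorphic_uniform_sequence[OF assms(1,2)])
  fix x assume "x \<in> S"
  then obtain d where "d > 0" "cball x d \<subseteq> S" using \<open>open S\<close> open_contains_cball by blast
  then show "\<exists>d>0. cball x d \<subseteq> S \<and> uniform_limit (cball x d) f g sequentially"
    by (intro exI[of _ d] conjI converges_continuously_imp_uniform_limit compact_cball assms(3)) auto
qed

section \<open>Strips and summable norms\<close>

lemma horizontal_strip_open: "horizontal_strip S \<Longrightarrow> open S"
  by (auto simp: horizontal_strip_def intro!: open_Collect_less continuous_intros)

lemma horizontal_strip_shift: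
  assumes "horizontal_strip S" "s \<in> S" "Im t = 0"
  shows "s + t \<in> S" "s - t \<in> S"
  using assms by (auto simp: horizontal_strip_def)

lemma sup_norm_upper:
  assumes "s \<in> K" "z \<in> cart_power N k"
  shows "ennreal (norm (f s z)) \<le> sup_norm k K N f"
  unfolding sup_norm_def using assms by (intro SUP_upper2[of s] SUP_upper2[of z]) auto

lemma summable_sup_norm_imp_small:
  assumes "(\<Sum>j. sup_norm k K N (f j)) < \<infinity>" and "\<eta> > 0"
  shows "\<exists>J. \<forall>j\<ge>J. \<forall>s\<in>K. \<forall>z\<in>cart_power N k. norm (f j s z) \<le> \<eta>"
proof -
  let ?u = "\<lambda>j. enn2real (sup_norm k K N (f j))"
  have fin: "sup_norm k K N (f j) \<noteq> top" for j
    using ennreal_suminf_lessD[OF assms(1), of j] by auto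
  then have u: "ennreal (?u j) = sup_norm k K N (f j)" for j
    by (simp add: less_top)
  have "summable ?u"
    by (rule summable_suminf_not_top) (use assms(1) in \<open>auto simp: u\<close>)
  then have "?u \<longlonglongrightarrow> 0" by (rule summable_LIMSEQ_zero)
  from order_tendstoD(2)[OF this \<open>\<eta> > 0\<close>]
  obtain J where J: "\<And>j. j \<ge> J \<Longrightarrow> ?u j < \<eta>" by (auto simp: eventually_sequentially)
  have "norm (f j s z) \<le> \<eta>" if "j \<ge> J" "s \<in> K" "z \<in> cart_power N k" for j s z
  proof -
    have "ennreal (norm (f j s z)) \<le> ennreal (?u j)"
      unfolding u by (rule sup_norm_upper[OF that(2,3)])
    then show ?thesis using J[OF that(1)] by (simp add: ennreal_le_iff)
  qed
  then show ?thesis by blast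
qed

section \<open>The recursion started far to the left\<close>

text \<open>Without this congruence rule the termination argument below could not use \<open>i < k\<close>.\<close>

lemma restrict_fundef_cong [fundef_cong]:
  "I = J \<Longrightarrow> (\<And>i. i \<in> J \<Longrightarrow> f i = g i) \<Longrightarrow> restrict f I = restrict g J"
  by (auto simp: restrict_def)

text \<open>The index \<open>n\<close> is the distance of \<open>s\<close> from the leftmost initial point \<open>s - n\<close>. Moving one
  step to the right within the same sequence therefore increases \<open>n\<close> and \<open>s\<close> simultaneously.\<close>

function march :: "nat \<Rightarrow> complex \<Rightarrow> (complex \<Rightarrow> (nat \<Rightarrow> complex) \<Rightarrow> complex)
    \<Rightarrow> nat \<Rightarrow> complex \<Rightarrow> complex" where
  "march k A F n s = (if n < k then A else
     F (s - of_nat k) (\<lambda>i\<in>{..<k}. march k A F (n - k + i) (s - of_nat k + of_nat i)))"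
  by auto
termination
  by (relation "Wellfounded.measure (\<lambda>(k, A, F, n, s). n)") auto

declare march.simps [simp del]

lemma march_less: "n < k \<Longrightarrow> march k A F n s = A"
  by (simp add: march.simps)

lemma march_ge: "k \<le> n \<Longrightarrow> march k A F n s =
     F (s - of_nat k) (\<lambda>i\<in>{..<k}. march k A F (n - k + i) (s - of_nat k + of_nat i))"
  by (subst march.simps) simp

lemma march_in_and_holomorphic:
  assumes S: "horizontal_strip S" and "open G" and "A \<in> G"
    and FG: "\<And>s z. s \<in> S \<Longrightarrow> z \<in> cart_power G k \<Longrightarrow> F s z \<in> G"
    and F: "jointly_holomorphic_on k F S G"
  shows "(\<forall>s\<in>S. march k A F n s \<in> G) \<and> march k A F n holomorphic_on S"
proof (induction n rule: less_induct)
  case (less n)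
  show ?case
  proof (cases "n < k")
    case True
    then have "march k A F n = (\<lambda>s. A)" by (auto simp: march_less)
    then show ?thesis using \<open>A \<in> G\<close> by simp
  next
    case False
    then have eq: "march k A F n = (\<lambda>s. F (s - of_nat k)
        (\<lambda>i\<in>{..<k}. march k A F (n - k + i) (s - of_nat k + of_nat i)))"
      by (auto simp: march_ge)
    have shift: "s - of_nat k \<in> S" "s - of_nat k + of_nat i \<in> S" if "s \<in> S" for s i
      using that by (auto intro!: horizontal_strip_shift[OF S])
    have val: "march k A F (n - k + i) (s - of_nat k + of_nat i) \<in> G" if "i < k" "s \<in> S" for i s
      using less[of "n - k + i"] that False shift by auto
    have "march k A F n holomorphic_on S"
      unfolding eq
    proof (rule holomorphic_on_jointly_holomorphic[OF F _ \<open>open G\<close>])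
      fix i assume "i < k"
      then have "march k A F (n - k + i) holomorphic_on S" using less[of "n - k + i"] False by auto
      then show "(\<lambda>s. march k A F (n - k + i) (s - of_nat k + of_nat i)) holomorphic_on S"
        by (rule holomorphic_on_compose_gen[unfolded o_def, rotated])
           (use shift in \<open>auto intro!: holomorphic_intros\<close>)
    qed (use horizontal_strip_open[OF S] shift val in \<open>auto intro!: holomorphic_intros\<close>)
    moreover have "march k A F n s \<in> G" if "s \<in> S" for s
      unfolding eq using shift val that by (intro FG) auto
    ultimately show ?thesis by blast
  qed
qed

lemma march_shifted_left:
  assumes "k \<le> n"
  shows "march k A F n (s - of_nat m) =
      F (s - of_nat (m + k)) (\<lambda>i\<in>{..<k}. march k A F (n - k + i) (s - of_nat (m + k - i)))"
  unfolding march_ge[OF assms]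
  by (intro arg_cong2[where f = F] restrict_ext) (auto simp: of_nat_diff algebra_simps)

text \<open>Far to the left the scheme never leaves the ball around \<open>A\<close>: as long as the \<open>k\<close> previous
  values lie in \<open>cball A r\<close>, the next one is a value of \<open>F\<close> on that ball and hence within
  \<open>\<eta> \<le> r\<close> of \<open>A\<close>, however many steps have been made.\<close>

lemma march_near_limit:
  assumes "0 \<le> \<eta>" "\<eta> \<le> r"
    and bound: "\<And>m z. m \<ge> J \<Longrightarrow> z \<in> cart_power (cball A r) k
        \<Longrightarrow> norm (F (s - of_nat m) z - A) \<le> \<eta>"
    and "m \<ge> J"
  shows "norm (march k A F n (s - of_nat m) - A) \<le> \<eta>"
  using \<open>m \<ge> J\<close>
proof (induction n arbitrary: m rule: less_induct)
  case (less n)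
  show ?case
  proof (cases "n < k")
    case True
    then show ?thesis using \<open>0 \<le> \<eta>\<close> by (simp add: march_less)
  next
    case False
    have "norm (march k A F (n - k + i) (s - of_nat (m + k - i)) - A) \<le> r" if "i < k" for i
    proof -
      have "norm (march k A F (n - k + i) (s - of_nat (m + k - i)) - A) \<le> \<eta>"
        using less.prems that False by (intro less.IH) auto
      also have "\<dots> \<le> r" by fact
      finally show ?thesis .
    qed
    then have "(\<lambda>i\<in>{..<k}. march k A F (n - k + i) (s - of_nat (m + k - i)))
        \<in> cart_power (cball A r) k"
      by (simp add: dist_norm norm_minus_commute[of A] del: of_nat_diff)
    from bound[OF _ this, of "m + k"] show ?thesis
      unfolding march_shifted_left[OF False[unfolded not_less]] using less.prems by simp
  qed
qed

text \<open>The value \<open>\<eta> = r / (8 * 2 ^ k)\<close> makes the Lipschitz constant \<open>8 * \<eta> / r\<close> of \<open>F\<close> equal to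
  \<open>(1 / 2) ^ k\<close>.  Since the arguments of \<open>F\<close> in the \<open>n\<close>-th iterate are iterates of index at least
  \<open>n - k\<close>, this is just what makes the bound \<open>C * (1 / 2) ^ n\<close> on the increments reproduce itself;
  \<open>C = \<eta> * 2 ^ k\<close> is dictated by the initial indices \<open>n < k\<close>.\<close>

lemma march_increment:
  assumes F: "jointly_holomorphic_on k F S G" and "open S" "open G" and "0 < r"
    and sub: "cball A r \<subseteq> G" and \<eta>: "\<eta> = r / (8 * 2 ^ k)"
    and S: "\<And>m. s - of_nat m \<in> S"
    and bound: "\<And>m z. m \<ge> J \<Longrightarrow> z \<in> cart_power (cball A r) k
        \<Longrightarrow> norm (F (s - of_nat m) z - A) \<le> \<eta>"
    and "m \<ge> J"
  shows "norm (march k A F (Suc n) (s - of_nat m) - march k A F n (s - of_nat m))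
           \<le> \<eta> * 2 ^ k * (1 / 2) ^ n"
proof -
  have "\<eta> > 0" using \<open>0 < r\<close> by (simp add: \<eta>)
  have "\<eta> * 1 \<le> \<eta> * 2 ^ k" using \<open>\<eta> > 0\<close> by (intro mult_left_mono) auto
  then have "\<eta> \<le> r / 8" using \<open>0 < r\<close> by (simp add: \<eta>)
  have near: "norm (march k A F n (s - of_nat m) - A) \<le> \<eta>" if "m \<ge> J" for m n
    by (rule march_near_limit[where F = F and s = s, OF _ _ bound that]) (use \<open>\<eta> > 0\<close> \<open>\<eta> \<le> r / 8\<close> \<open>0 < r\<close> in auto)
  show "norm (march k A F (Suc n) (s - of_nat m) - march k A F n (s - of_nat m))
           \<le> \<eta> * 2 ^ k * (1 / 2) ^ n"
    using \<open>m \<ge> J\<close>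
  proof (induction n arbitrary: m rule: less_induct)
    case (less n)
    show ?case
    proof (cases "n < k")
      case True
      have "norm (march k A F (Suc n) (s - of_nat m) - march k A F n (s - of_nat m)) \<le> \<eta> * 1"
        using near[OF less.prems, of "Suc n"] True by (simp add: march_less)
      also have "\<dots> \<le> \<eta> * (2 ^ k * (1 / 2) ^ n)"
        using True \<open>\<eta> > 0\<close> by (intro mult_left_mono) (auto simp: field_simps power_increasing)
      finally show ?thesis by (simp add: mult.assoc)
    next
      case False
      define \<delta> where "\<delta> = \<eta> * 2 ^ k * (1 / 2) ^ (n - k)"
      have "\<delta> > 0" using \<open>\<eta> > 0\<close> by (simp add: \<delta>_def)
      have "\<delta> \<le> \<eta> * 2 ^ k * 1"
        unfolding \<delta>_def using \<open>\<eta> > 0\<close> by (intro mult_left_mono power_le_one) auto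
      also have "\<dots> \<le> r / 4" using \<open>0 < r\<close> by (simp add: \<eta>)
      finally have "\<delta> \<le> r / 4" .
      have "norm (F (s - of_nat (m + k)) (\<lambda>i\<in>{..<k}. march k A F (Suc n - k + i) (s - of_nat (m + k - i)))
          - F (s - of_nat (m + k)) (\<lambda>i\<in>{..<k}. march k A F (n - k + i) (s - of_nat (m + k - i))))
        \<le> 8 * \<eta> * \<delta> / r"
      proof (rule jointly_holomorphic_Lipschitz[OF F \<open>open S\<close> \<open>open G\<close> S sub \<open>\<delta> > 0\<close> \<open>\<delta> \<le> r / 4\<close>])
        show "norm (F (s - of_nat (m + k)) z - A) \<le> \<eta>" if "z \<in> cart_power (cball A r) k" for z
          by (rule bound[OF _ that]) (use less.prems in simp)
        fix i assume "i < k"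
        show "norm (march k A F (n - k + i) (s - of_nat (m + k - i)) - A) \<le> r / 2"
          by (rule order_trans[OF near]) (use less.prems \<open>i < k\<close> \<open>\<eta> \<le> r / 8\<close> \<open>0 < r\<close> in auto)
        have "norm (march k A F (Suc (n - k + i)) (s - of_nat (m + k - i))
            - march k A F (n - k + i) (s - of_nat (m + k - i)))
          \<le> \<eta> * 2 ^ k * (1 / 2) ^ (n - k + i)"
          using less.prems \<open>i < k\<close> False by (intro less.IH) auto
        also have "\<dots> \<le> \<delta>"
          unfolding \<delta>_def using \<open>\<eta> > 0\<close> by (intro mult_left_mono power_decreasing) auto
        finally show "norm (march k A F (Suc n - k + i) (s - of_nat (m + k - i))
            - march k A F (n - k + i) (s - of_nat (m + k - i))) \<le> \<delta>"
          using False by (simp add: Suc_diff_le)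
      qed
      also have "8 * \<eta> * \<delta> / r = \<eta> * 2 ^ k * (1 / 2) ^ n"
      proof -
        have "8 * \<eta> / r = (1 / 2) ^ k" using \<open>0 < r\<close> by (simp add: \<eta> power_divide)
        then have "8 * \<eta> * \<delta> / r = (1 / 2) ^ k * \<delta>" by (metis times_divide_eq_left)
        also have "\<dots> = \<eta> * 2 ^ k * ((1 / 2) ^ k * (1 / 2) ^ (n - k))" by (simp add: \<delta>_def)
        also have "(1 / 2) ^ k * (1 / 2) ^ (n - k) = (1 / 2 :: real) ^ n"
          using False by (simp flip: power_add)
        finally show ?thesis .
      qed
      finally show ?thesis using False by (simp add: march_shifted_left)
    qed
  qed
qed

section \<open>Spreading the convergence to the right\<close>

text \<open>The shift \<open>(n, u) \<mapsto> (n - k + i, u - k + i)\<close> carries the filter of continuous convergence at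
  \<open>s\<close> to that at \<open>s - k + i\<close>, so all arguments of \<open>F\<close> converge.\<close>

lemma march_converges_step:
  assumes F: "jointly_holomorphic_on k F S G" and "open S" "open G" and "s - of_nat k \<in> S"
    and FG: "\<And>z. z \<in> cart_power G k \<Longrightarrow> F (s - of_nat k) z \<in> G"
    and conv: "\<And>i. i < k \<Longrightarrow> \<exists>l\<in>G. converges_continuously_at (march k A F) l (s - of_nat k + of_nat i)"
  shows "\<exists>l\<in>G. converges_continuously_at (march k A F) l s"
proof -
  from conv obtain l where lG: "\<And>i. i < k \<Longrightarrow> l i \<in> G"
    and l: "\<And>i. i < k \<Longrightarrow> converges_continuously_at (march k A F) (l i) (s - of_nat k + of_nat i)"
    by metis
  let ?L = "sequentially \<times>\<^sub>F nhds s"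
  have n: "filterlim (fst :: nat \<times> complex \<Rightarrow> nat) sequentially ?L" by (rule filterlim_fst)
  have s: "((snd :: nat \<times> complex \<Rightarrow> complex) \<longlongrightarrow> s) ?L" by (rule filterlim_snd)
  have args: "((\<lambda>p. march k A F (fst p - k + i) (snd p - of_nat k + of_nat i)) \<longlongrightarrow> l i) ?L"
    if "i < k" for i
  proof -
    have "filterlim (\<lambda>n. n - k + i) sequentially sequentially"
      by (rule filterlim_at_top_mono[OF filterlim_minus_const_nat_at_top[of k]]) auto
    then have "filterlim (\<lambda>p :: nat \<times> complex. (fst p - k + i, snd p - of_nat k + of_nat i))
        (sequentially \<times>\<^sub>F nhds (s - of_nat k + of_nat i)) ?L"
      by (intro filterlim_Pair tendsto_intros s) (rule filterlim_compose[OF _ n])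
    from filterlim_compose[OF l[OF that] this] show ?thesis by simp
  qed
  have "((\<lambda>p. F (snd p - of_nat k)
        (\<lambda>i\<in>{..<k}. march k A F (fst p - k + i) (snd p - of_nat k + of_nat i)))
      \<longlongrightarrow> F (s - of_nat k) (\<lambda>i\<in>{..<k}. l i)) ?L"
    by (rule tendsto_jointly_holomorphic[OF F \<open>open S\<close> \<open>open G\<close> \<open>s - of_nat k \<in> S\<close> lG _ args])
       (auto intro!: tendsto_intros s)
  moreover have "\<forall>\<^sub>F p in ?L. F (snd p - of_nat k)
        (\<lambda>i\<in>{..<k}. march k A F (fst p - k + i) (snd p - of_nat k + of_nat i))
      = march k A F (fst p) (snd p)"
    using eventually_compose_filterlim[OF eventually_ge_at_top[of k] n]
    by eventually_elim (simp add: march_ge)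
  ultimately have "converges_continuously_at (march k A F) (F (s - of_nat k) (\<lambda>i\<in>{..<k}. l i)) s"
    by (rule Lim_transform_eventually)
  moreover have "F (s - of_nat k) (\<lambda>i\<in>{..<k}. l i) \<in> G" using lG by (intro FG) auto
  ultimately show ?thesis by blast
qed

theorem theorem4p1:
  fixes k :: nat
    and S G :: "complex set"
    and F :: "complex \<Rightarrow> (nat \<Rightarrow> complex) \<Rightarrow> complex"
    and A :: complex
  assumes "k \<ge> 1"
    and "horizontal_strip S"
    and "complex_domain G"
    and "\<And>s z. s \<in> S \<Longrightarrow> z \<in> cart_power G k \<Longrightarrow> F s z \<in> G"
    and "jointly_holomorphic_on k F S G"
    and "A \<in> G"
    and "\<And>K N. compact K \<Longrightarrow> K \<subseteq> S \<Longrightarrow> compact N \<Longrightarrow> N \<subseteq> G \<Longrightarrow>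
           (\<Sum>j. sup_norm k K N (\<lambda>s z. F (s - of_nat (Suc j)) z - A)) < \<infinity>"
  shows "\<exists>y. y holomorphic_on S \<and> y ` S \<subseteq> G \<and>
           (\<forall>s\<in>S. y (s + of_nat k) = F s (\<lambda>i\<in>{..<k}. y (s + of_nat i)))"
proof -
  note strip = assms(2) and FG = assms(4) and F = assms(5)
  have "open S" using strip by (rule horizontal_strip_open)
  have "open G" using assms(3) by (simp add: complex_domain_def)
  have Splus: "s + of_nat m \<in> S" and Sminus: "s - of_nat m \<in> S" if "s \<in> S" for s m
    using horizontal_strip_shift[OF strip that] by simp_all
  note march = march_in_and_holomorphic[OF strip \<open>open G\<close> \<open>A \<in> G\<close> FG F]
  let ?M = "march k A F"

  \<comment> \<open>The compact set is a disc around \<open>s\<close> rather than \<open>{s}\<close>, since continuous convergence at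
    \<open>s - m\<close> needs the estimates, with the same threshold \<open>J\<close>, on a neighbourhood.\<close>
  have left: "\<exists>J. \<forall>m\<ge>J. \<exists>l\<in>G. converges_continuously_at ?M l (s - of_nat m)" if "s \<in> S" for s
  proof -
    from \<open>open G\<close> \<open>A \<in> G\<close> obtain r where "r > 0" and r: "cball A r \<subseteq> G"
      using open_contains_cball by blast
    from \<open>open S\<close> \<open>s \<in> S\<close> obtain d where "d > 0" and d: "cball s d \<subseteq> S"
      using open_contains_cball by blast
    define \<eta> where "\<eta> = r / (8 * 2 ^ k)"
    have "\<eta> > 0" using \<open>r > 0\<close> by (simp add: \<eta>_def)
    have "(1 :: real) \<le> 2 ^ k" by simp
    then have "(1 :: real) \<le> 8 * 2 ^ k" by linarith
    then have "\<eta> \<le> r" using \<open>r > 0\<close> by (simp add: \<eta>_def divide_le_eq)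
    from summable_sup_norm_imp_small[OF assms(7)[OF compact_cball d compact_cball r] \<open>\<eta> > 0\<close>]
    obtain J where J: "\<And>j s' z. j \<ge> J \<Longrightarrow> s' \<in> cball s d \<Longrightarrow> z \<in> cart_power (cball A r) k
        \<Longrightarrow> norm (F (s' - of_nat (Suc j)) z - A) \<le> \<eta>" by blast
    have bound: "norm (F (s' - of_nat m) z - A) \<le> \<eta>"
      if "m \<ge> Suc J" "s' \<in> cball s d" "z \<in> cart_power (cball A r) k" for m s' z
      using J[of "m - 1" s' z] that by simp
    have K: "s' - of_nat m \<in> S" if "s' \<in> cball s d" for s' m
      using Sminus d that by blast
    have "\<exists>l\<in>G. converges_continuously_at ?M l (s - of_nat m)" if "m \<ge> Suc J" for m
    proof -
      have K': "u + of_nat m \<in> cball s d" if "u \<in> ball (s - of_nat m) d" for u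
        using that by (simp add: dist_norm algebra_simps)
      have "\<exists>l. converges_continuously_at ?M l (s - of_nat m)"
      proof (rule geometric_imp_converges_continuously)
        show "open (ball (s - of_nat m) d)" "s - of_nat m \<in> ball (s - of_nat m) d"
          using \<open>d > 0\<close> by auto
        show "norm (?M (Suc n) u - ?M n u) \<le> \<eta> * 2 ^ k * (1 / 2) ^ n"
          if "u \<in> ball (s - of_nat m) d" for n u
          using march_increment[OF F \<open>open S\<close> \<open>open G\<close> \<open>r > 0\<close> r \<eta>_def
              K[OF K'[OF that]] bound[OF _ K'[OF that]] \<open>m \<ge> Suc J\<close>] by simp
        have "ball (s - of_nat m) d \<subseteq> S"
          using K[OF K', of _ m] by auto
        then show "continuous_on (ball (s - of_nat m) d) (?M n)" for n
          using march holomorphic_on_imp_continuous_on holomorphic_on_subset by blast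
      qed
      then obtain l where l: "converges_continuously_at ?M l (s - of_nat m)" ..
      have "norm (?M n (s - of_nat m) - A) \<le> \<eta>" for n
        by (rule march_near_limit[where F = F and s = s, OF _ \<open>\<eta> \<le> r\<close> bound that]) (use \<open>\<eta> > 0\<close> \<open>d > 0\<close> in auto)
      then have "norm (l - A) \<le> \<eta>"
        using converges_continuously_imp_tendsto[OF l]
        by (intro tendsto_upperbound[OF tendsto_norm[OF tendsto_diff[OF _ tendsto_const]]]) auto
      then have "l \<in> G" using r \<open>\<eta> \<le> r\<close> by (auto simp: dist_norm norm_minus_commute)
      with l show ?thesis by blast
    qed
    then show ?thesis by blast
  qed

  have everywhere: "\<exists>l\<in>G. converges_continuously_at ?M l s" if "s \<in> S" for s
  proof -
    from left[OF that] obtain J where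
      J: "\<And>m. m \<ge> J \<Longrightarrow> \<exists>l\<in>G. converges_continuously_at ?M l (s - of_nat m)" by blast
    \<comment> \<open>The \<open>k\<close> points \<open>s0, \<dots>, s0 + k - 1\<close> all lie so far to the left that \<open>J\<close> applies; they start
      the induction to the right, which reaches \<open>s\<close> after \<open>J + k\<close> steps.\<close>
    define s0 where "s0 = s - of_nat (J + k)"
    have "s0 \<in> S" unfolding s0_def using that by (rule Sminus)
    have "\<exists>l\<in>G. converges_continuously_at ?M l (s0 + of_nat i)" for i
    proof (induction i rule: less_induct)
      case (less i)
      show ?case
      proof (cases "i < k")
        case True
        then have eq: "s0 + of_nat i = s - of_nat (J + k - i)" by (simp add: s0_def of_nat_diff)
        show ?thesis unfolding eq by (rule J) (use True in simp)
      next
        case False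
        have eq: "s0 + of_nat i - of_nat k + of_nat i' = s0 + of_nat (i - k + i')" for i'
          using False by (simp add: of_nat_diff)
        show ?thesis
        proof (rule march_converges_step[OF F \<open>open S\<close> \<open>open G\<close>])
          show *: "s0 + of_nat i - of_nat k \<in> S"
            by (intro Sminus Splus \<open>s0 \<in> S\<close>)
          show "F (s0 + of_nat i - of_nat k) z \<in> G" if "z \<in> cart_power G k" for z
            using * that by (rule FG)
          show "\<exists>l\<in>G. converges_continuously_at ?M l (s0 + of_nat i - of_nat k + of_nat i')"
            if "i' < k" for i'
            unfolding eq using that False by (intro less) auto
        qed
      qed
    qed
    from this[of "J + k"] show ?thesis by (simp add: s0_def)
  qed

  then obtain y where yG: "\<And>s. s \<in> S \<Longrightarrow> y s \<in> G"
    and y: "\<And>s. s \<in> S \<Longrightarrow> converges_continuously_at ?M (y s) s" by metis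
  have lim: "(\<lambda>n. ?M (n + i) (s + of_nat i)) \<longlonglongrightarrow> y (s + of_nat i)" if "s \<in> S" for s i
    using converges_continuously_imp_tendsto[OF y[OF Splus[OF that, of i]]]
    by (rule LIMSEQ_ignore_initial_segment)
  have "y (s + of_nat k) = F s (\<lambda>i\<in>{..<k}. y (s + of_nat i))" if "s \<in> S" for s
  proof (rule LIMSEQ_unique[OF lim[OF that]])
    have "(\<lambda>n. F s (\<lambda>i\<in>{..<k}. ?M (n + i) (s + of_nat i)))
        \<longlonglongrightarrow> F s (\<lambda>i\<in>{..<k}. y (s + of_nat i))"
      by (rule tendsto_jointly_holomorphic[OF F \<open>open S\<close> \<open>open G\<close> that])
         (use yG Splus that lim in auto)
    then show "(\<lambda>n. ?M (n + k) (s + of_nat k)) \<longlonglongrightarrow> F s (\<lambda>i\<in>{..<k}. y (s + of_nat i))"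
      by (simp add: march_ge)
  qed
  moreover have "y holomorphic_on S"
    by (rule converges_continuously_imp_holomorphic[OF \<open>open S\<close> _ y]) (use march in blast)
  ultimately show ?thesis using yG by blast
qed

end
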